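(* Let $n$ be a power of $2$, and let $v_1,\dots,v_n\in\{\pm1\}^n$ be a Hadamard basis of $\mathbb{R}^n$ with $v_1$ the all-ones vector; let $y_i=v_i/\sqrt n$, $S_i=\{j: (v_i)_j=+1\}$ and $\bar S_i=[n]\setminus S_i$. Consider the algorithm which, given value-query access to a set function $f$ over $[n]$, queries $f(\emptyset)$ and $f(S_i),f(\bar S_i)$ for all $i\in[n]$, sets $h_0=f(\emptyset)$, and for each $j\in[n]$ writes the indicator vector $e_j$ of $\{j\}$ as $e_j=\sum_{i=1}^n\lambda_i y_i$ and sets $h_j=\frac1{\sqrt n}\sum_{i=1}^n\lambda_i(f(S_i)-f(\bar S_i))$, and outputs the linear set function $h(S)=h_0+\sum_{j\in S}h_j$. If $f$ is $\Delta$-linear, then this algorithm runs in polynomial time and its output satisfies $|h(S)-f(S)|=O\big(\Delta(1+\sqrt{\min\{|S|,n-|S|\}})\big)$ for every $S\subseteq[n]$; in particular $|h(S)-f(S)|=O(\Delta\sqrt n)$ for all $S$.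
   Context: A Hadamard basis is an orthogonal basis of $\mathbb{R}^n$ consisting of vectors in $\{\pm1\}^n$. A set function over $[n]$ is a map $f:2^{[n]}\to\mathbb{R}$; it is linear if $f(S)=c_0+\sum_{i\in S}c_i$ for constants $c_0,\dots,c_n$, and $\Delta$-linear if some linear $\ell$ satisfies $|f(S)-\ell(S)|\le\Delta$ for all $S$. The constants in $O(\cdot)$ are absolute. *)

theory Defs
  imports Complex_Main "HOL-Computational_Algebra.Polynomial"
begin

section \<open>Set functions and Hadamard bases\<close>

text \<open>
  The ground set \<open>[n]\<close> is \<open>{1..n}\<close>. A set function over \<open>[n]\<close> is a function on \<open>nat set\<close> of which
  only the values on subsets of \<open>{1..n}\<close> matter; a vector of \<open>\<real>\<^sup>n\<close> is a function on \<open>nat\<close> of which only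
  the values on \<open>{1..n}\<close> matter. Families \<open>v\<^sub>1, \<dots>, v\<^sub>n\<close> are curried: \<open>v i k\<close> is \<open>(v\<^sub>i)\<^sub>k\<close>.
\<close>

definition linear_set_fun :: "(nat \<Rightarrow> real) \<Rightarrow> nat set \<Rightarrow> real" where
  "linear_set_fun c S = c 0 + (\<Sum>i\<in>S. c i)"

definition is_linear :: "nat \<Rightarrow> (nat set \<Rightarrow> real) \<Rightarrow> bool" where
  "is_linear n l \<longleftrightarrow> (\<exists>c. \<forall>S\<subseteq>{1..n}. l S = linear_set_fun c S)"

definition delta_linear :: "nat \<Rightarrow> real \<Rightarrow> (nat set \<Rightarrow> real) \<Rightarrow> bool" where
  "delta_linear n \<Delta> f \<longleftrightarrow> (\<exists>l. is_linear n l \<and> (\<forall>S\<subseteq>{1..n}. \<bar>f S - l S\<bar> \<le> \<Delta>))"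

definition lin_indep :: "nat \<Rightarrow> (nat \<Rightarrow> nat \<Rightarrow> real) \<Rightarrow> bool" where
  "lin_indep n v \<longleftrightarrow>
     (\<forall>a. (\<forall>k\<in>{1..n}. (\<Sum>i=1..n. a i * v i k) = 0) \<longrightarrow> (\<forall>i\<in>{1..n}. a i = 0))"

definition spanning :: "nat \<Rightarrow> (nat \<Rightarrow> nat \<Rightarrow> real) \<Rightarrow> bool" where
  "spanning n v \<longleftrightarrow> (\<forall>x. \<exists>a. \<forall>k\<in>{1..n}. x k = (\<Sum>i=1..n. a i * v i k))"

definition hadamard_basis :: "nat \<Rightarrow> (nat \<Rightarrow> nat \<Rightarrow> real) \<Rightarrow> bool" where
  "hadamard_basis n v \<longleftrightarrow>
     (\<forall>i\<in>{1..n}. \<forall>k\<in>{1..n}. v i k \<in> {1, -1}) \<and>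
     (\<forall>i\<in>{1..n}. \<forall>j\<in>{1..n}. i \<noteq> j \<longrightarrow> (\<Sum>k=1..n. v i k * v j k) = 0) \<and>
     lin_indep n v \<and> spanning n v"

definition pos_set :: "nat \<Rightarrow> (nat \<Rightarrow> nat \<Rightarrow> real) \<Rightarrow> nat \<Rightarrow> nat set" where
  "pos_set n v i = {j \<in> {1..n}. v i j = 1}"

definition neg_set :: "nat \<Rightarrow> (nat \<Rightarrow> nat \<Rightarrow> real) \<Rightarrow> nat \<Rightarrow> nat set" where
  "neg_set n v i = {1..n} - pos_set n v i"

text \<open>
  \<open>hadamard_coeffs n v f lam h\<close>: row \<open>j\<close> of \<open>lam\<close> expands \<open>e\<^sub>j\<close> in the vectors \<open>y\<^sub>i = v\<^sub>i / \<surd>n\<close>, and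
  \<open>h 0, \<dots>, h n\<close> are the coefficients that the algorithm has to output.
\<close>

definition hadamard_coeffs ::
  "nat \<Rightarrow> (nat \<Rightarrow> nat \<Rightarrow> real) \<Rightarrow> (nat set \<Rightarrow> real) \<Rightarrow> (nat \<Rightarrow> nat \<Rightarrow> real) \<Rightarrow> (nat \<Rightarrow> real) \<Rightarrow> bool" where
  "hadamard_coeffs n v f lam h \<longleftrightarrow>
     (\<forall>j\<in>{1..n}. \<forall>k\<in>{1..n}.
        (if k = j then 1 else 0) = (\<Sum>i=1..n. lam j i * (v i k / sqrt (real n)))) \<and>
     h 0 = f {} \<and>
     (\<forall>j\<in>{1..n}.
        h j = 1 / sqrt (real n) * (\<Sum>i=1..n. lam j i * (f (pos_set n v i) - f (neg_set n v i))))"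


section \<open>A real RAM with value queries\<close>

text \<open>
  Running time is measured on while programs over exact reals: each arithmetic operation
  (\<open>+\<close>, \<open>-\<close>, \<open>*\<close>, \<open>/\<close>, square root), comparison and memory access has unit cost. The index registers,
  which hold natural numbers, address the real memory and can only be copied, incremented,
  compared and converted to a real.
\<close>

datatype iexp = IConst nat | IVar string | ISucc iexp

datatype rexp =
    Num int
  | OfIndex iexp
  | Ref string "iexp list"
  | Add rexp rexp
  | Sub rexp rexp
  | Mul rexp rexp
  | Div rexp rexp
  | Sqrt rexp

datatype bexp = ILe iexp iexp | Pos rexp

datatype cmd =
    ISet string iexp
  | RSet string "iexp list" rexp
  | Query string "iexp list" string
  | Seq cmd cmd  (infixr \<open>;;\<close> 60)
  | Cond bexp cmd cmd
  | While bexp cmd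

type_synonym state = "(string \<Rightarrow> nat) \<times> (string \<Rightarrow> nat list \<Rightarrow> real)"

fun ival :: "iexp \<Rightarrow> state \<Rightarrow> nat" where
  "ival (IConst m) s = m"
| "ival (IVar x) s = fst s x"
| "ival (ISucc e) s = Suc (ival e s)"

fun icost :: "iexp \<Rightarrow> nat" where
  "icost (IConst m) = 1"
| "icost (IVar x) = 1"
| "icost (ISucc e) = icost e + 1"

fun rval :: "rexp \<Rightarrow> state \<Rightarrow> real" where
  "rval (Num m) s = of_int m"
| "rval (OfIndex e) s = real (ival e s)"
| "rval (Ref a es) s = snd s a (map (\<lambda>e. ival e s) es)"
| "rval (Add p q) s = rval p s + rval q s"
| "rval (Sub p q) s = rval p s - rval q s"
| "rval (Mul p q) s = rval p s * rval q s"
| "rval (Div p q) s = rval p s / rval q s"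
| "rval (Sqrt p) s = sqrt (rval p s)"

fun rcost :: "rexp \<Rightarrow> nat" where
  "rcost (Num m) = 1"
| "rcost (OfIndex e) = icost e + 1"
| "rcost (Ref a es) = sum_list (map icost es) + 1"
| "rcost (Add p q) = rcost p + rcost q + 1"
| "rcost (Sub p q) = rcost p + rcost q + 1"
| "rcost (Mul p q) = rcost p + rcost q + 1"
| "rcost (Div p q) = rcost p + rcost q + 1"
| "rcost (Sqrt p) = rcost p + 1"

fun bval :: "bexp \<Rightarrow> state \<Rightarrow> bool" where
  "bval (ILe d e) s \<longleftrightarrow> ival d s \<le> ival e s"
| "bval (Pos p) s \<longleftrightarrow> 0 < rval p s"

fun bcost :: "bexp \<Rightarrow> nat" where
  "bcost (ILe d e) = icost d + icost e + 1"
| "bcost (Pos p) = rcost p + 1"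

definition iset :: "string \<Rightarrow> nat \<Rightarrow> state \<Rightarrow> state" where
  "iset x m s = ((fst s)(x := m), snd s)"

definition rset :: "string \<Rightarrow> nat list \<Rightarrow> real \<Rightarrow> state \<Rightarrow> state" where
  "rset a is r s = (fst s, (snd s)(a := (snd s a)(is := r)))"

definition indicated_set :: "nat \<Rightarrow> string \<Rightarrow> state \<Rightarrow> nat set" where
  "indicated_set n a s = {k \<in> {1..n}. snd s a [k] = 1}"

text \<open>
  \<open>exec n f c s s' t qs\<close>: with value-query oracle \<open>f\<close> over \<open>[n]\<close>, program \<open>c\<close> started in \<open>s\<close>
  terminates in \<open>s'\<close> after time \<open>t\<close>, having submitted the queries \<open>qs\<close> in this order. The set to be
  queried is handed over as an indicator vector, and the \<open>n\<close> entries of that vector are charged for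
  in addition to the query. The program text sees \<open>n\<close> and \<open>f\<close> only through its memory and queries.
\<close>

inductive exec ::
  "nat \<Rightarrow> (nat set \<Rightarrow> real) \<Rightarrow> cmd \<Rightarrow> state \<Rightarrow> state \<Rightarrow> nat \<Rightarrow> nat set list \<Rightarrow> bool"
  for n :: nat and f :: "nat set \<Rightarrow> real" where
  ISet: "exec n f (ISet x e) s (iset x (ival e s) s) (icost e + 1) []"
| RSet: "exec n f (RSet a es p) s (rset a (map (\<lambda>e. ival e s) es) (rval p s) s)
           (sum_list (map icost es) + rcost p + 1) []"
| Query: "Q = indicated_set n a s \<Longrightarrow>
    exec n f (Query b es a) s (rset b (map (\<lambda>e. ival e s) es) (f Q) s)
      (sum_list (map icost es) + n + 1) [Q]"
| Seq: "exec n f c s s' t qs \<Longrightarrow> exec n f d s' s'' u rs \<Longrightarrow>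
    exec n f (c ;; d) s s'' (t + u) (qs @ rs)"
| CondTrue: "bval b s \<Longrightarrow> exec n f c s s' t qs \<Longrightarrow> exec n f (Cond b c d) s s' (bcost b + t) qs"
| CondFalse: "\<not> bval b s \<Longrightarrow> exec n f d s s' t qs \<Longrightarrow> exec n f (Cond b c d) s s' (bcost b + t) qs"
| WhileFalse: "\<not> bval b s \<Longrightarrow> exec n f (While b c) s s (bcost b) []"
| WhileTrue: "bval b s \<Longrightarrow> exec n f c s s' t qs \<Longrightarrow> exec n f (While b c) s' s'' u rs \<Longrightarrow>
    exec n f (While b c) s s'' (bcost b + t + u) (qs @ rs)"

inductive_cases ISetE: "exec n f (ISet x e) s s' t qs"
inductive_cases RSetE: "exec n f (RSet a es p) s s' t qs"
inductive_cases QueryE: "exec n f (Query b es a) s s' t qs"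
inductive_cases SeqE: "exec n f (c ;; d) s s' t qs"
inductive_cases CondE: "exec n f (Cond b c d) s s' t qs"
inductive_cases WhileE: "exec n f (While b c) s s' t qs"

lemma exec_deterministic:
  assumes "exec n f c s s' t qs" and "exec n f c s s'' u rs"
  shows "s'' = s' \<and> u = t \<and> rs = qs"
  using assms
proof (induction arbitrary: s'' u rs rule: exec.induct)
  case (ISet x e s)
  then show ?case by (auto elim: ISetE)
next
  case (RSet a es p s)
  then show ?case by (auto elim: RSetE)
next
  case (Query Q a s b es)
  then show ?case by (auto elim: QueryE)
next
  case (Seq c s s1 t qs d s2 t' qs')
  from Seq.prems show ?case by (rule SeqE) (use Seq.IH in blast)
next
  case (CondTrue b s c s1 t qs d)
  from CondTrue.prems show ?case by (rule CondE) (use CondTrue.IH CondTrue.hyps in blast)+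
next
  case (CondFalse b s d s1 t qs c)
  from CondFalse.prems show ?case by (rule CondE) (use CondFalse.IH CondFalse.hyps in blast)+
next
  case (WhileFalse b s c)
  from WhileFalse.prems show ?case by (rule WhileE) (use WhileFalse.hyps in blast)+
next
  case (WhileTrue b s c s1 t qs s2 t' qs')
  from WhileTrue.prems show ?case by (rule WhileE) (use WhileTrue.IH WhileTrue.hyps in blast)+
qed


section \<open>The algorithm\<close>

definition For :: "string \<Rightarrow> cmd \<Rightarrow> cmd" where
  "For x c = ISet x (IConst 1) ;;
     While (ILe (IVar x) (IVar ''n'')) (c ;; ISet x (ISucc (IVar x)))"

text \<open>
  On entry the index register \<open>n\<close> holds \<open>n\<close> and the array \<open>v\<close> holds the Hadamard basis;
  everything else is zero.
\<close>

definition input_state :: "nat \<Rightarrow> (nat \<Rightarrow> nat \<Rightarrow> real) \<Rightarrow> state" where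
  "input_state n v =
     ((\<lambda>_. 0)(''n'' := n),
      (\<lambda>_ _. 0)(''v'' := (\<lambda>is. case is of
         [i, k] \<Rightarrow> if i \<in> {1..n} \<and> k \<in> {1..n} then v i k else 0 | _ \<Rightarrow> 0)))"

abbreviation ri :: iexp where "ri \<equiv> IVar ''i''"
abbreviation rj :: iexp where "rj \<equiv> IVar ''j''"
abbreviation rk :: iexp where "rk \<equiv> IVar ''k''"
abbreviation sqrt_n :: rexp where "sqrt_n \<equiv> Sqrt (OfIndex (IVar ''n''))"

definition query_empty :: cmd where
  "query_empty =
     For ''k'' (RSet ''A'' [rk] (Num 0)) ;;
     Query ''h'' [IConst 0] ''A''"

text \<open>
  The arrays \<open>A\<close> and \<open>B\<close> are filled with the indicator vectors of \<open>S\<^sub>i\<close> and of its complement;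
  \<open>p\<close> and \<open>q\<close> collect the answers.
\<close>

definition query_basis :: cmd where
  "query_basis =
     For ''i''
       (For ''k''
          (Cond (Pos (Ref ''v'' [ri, rk]))
             (RSet ''A'' [rk] (Num 1) ;; RSet ''B'' [rk] (Num 0))
             (RSet ''A'' [rk] (Num 0) ;; RSet ''B'' [rk] (Num 1)) ;;
           RSet ''y'' [ri, rk] (Div (Ref ''v'' [ri, rk]) sqrt_n)) ;;
        Query ''p'' [ri] ''A'' ;;
        Query ''q'' [ri] ''B'')"

text \<open>
  The \<open>y\<^sub>i\<close> are orthonormal, so the coefficient of \<open>y\<^sub>i\<close> in the expansion of \<open>e\<^sub>j\<close> is the inner
  product of \<open>e\<^sub>j\<close> and \<open>y\<^sub>i\<close>, that is, the entry \<open>j\<close> of \<open>y\<^sub>i\<close>.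
\<close>

definition compute_coeffs :: cmd where
  "compute_coeffs =
     For ''j''
       (For ''i'' (RSet ''lambda'' [rj, ri] (Ref ''y'' [ri, rj])) ;;
        RSet ''h'' [rj] (Num 0) ;;
        For ''i'' (RSet ''h'' [rj]
          (Add (Ref ''h'' [rj])
               (Mul (Ref ''lambda'' [rj, ri]) (Sub (Ref ''p'' [ri]) (Ref ''q'' [ri]))))) ;;
        RSet ''h'' [rj] (Mul (Div (Num 1) sqrt_n) (Ref ''h'' [rj])))"

definition hadamard_alg :: cmd where
  "hadamard_alg = query_empty ;; query_basis ;; compute_coeffs"

definition output_coeffs :: "state \<Rightarrow> nat \<Rightarrow> real" where
  "output_coeffs s j = snd s ''h'' [j]"

definition lambda_array :: "state \<Rightarrow> nat \<Rightarrow> nat \<Rightarrow> real" where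
  "lambda_array s j i = snd s ''lambda'' [j, i]"

end

theory Submission
  imports Defs "HOL-Analysis.Convex"
begin

text \<open>
  The algorithm is linear in \<open>f\<close> and exact on linear functions, so only the part \<open>g\<close> of \<open>f\<close> with
  \<open>|g| \<le> \<Delta>\<close> contributes to the error. With \<open>w i = g S\<^sub>i - g (complement of S\<^sub>i)\<close>, its contribution to
  \<open>h S\<close> is \<open>g {} + (1/n) \<Sum>\<^sub>i w i \<langle>v\<^sub>i, 1\<^sub>S\<rangle>\<close>, and Cauchy-Schwarz together with
  \<open>\<Sum>\<^sub>i \<langle>v\<^sub>i, 1\<^sub>S\<rangle>\<^sup>2 = n |S|\<close> bounds the sum by \<open>2 \<Delta> \<surd>|S|\<close>. As \<open>v\<^sub>1\<close> is the all-ones vector, for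
  \<open>S = [n]\<close> the sum is just \<open>w 1\<close>, so \<open>S\<close> may be exchanged for its complement at the cost of \<open>2 \<Delta>\<close>.
\<close>

section \<open>Hadamard bases\<close>

lemma hadamard_rows:
  assumes "hadamard_basis n v" "i \<in> {1..n}" "m \<in> {1..n}"
  shows "(\<Sum>k=1..n. v i k * v m k) = (if i = m then real n else 0)"
proof (cases "i = m")
  case True
  have "v i k * v i k = 1" if "k \<in> {1..n}" for k
  proof -
    have "v i k \<in> {1, -1}"
      using assms that by (simp add: hadamard_basis_def)
    then show ?thesis by auto
  qed
  then have "(\<Sum>k=1..n. v i k * v i k) = (\<Sum>k=1..n. 1)"
    by (intro sum.cong) auto
  with True show ?thesis by simp
next
  case False
  with assms show ?thesis by (simp add: hadamard_basis_def)
qed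

text \<open>Orthogonality of the rows of a square matrix passes to its columns. Instead of inverting
  the matrix, the proof expands the unit vector of \<open>j\<close> in the rows, which span: row
  orthogonality identifies the coefficients as \<open>v m j / n\<close>, and coordinate
  \<open>k\<close> of the expansion is then the claim.\<close>

lemma hadamard_columns:
  assumes "hadamard_basis n v" "j \<in> {1..n}" "k \<in> {1..n}"
  shows "(\<Sum>i=1..n. v i j * v i k) = (if k = j then real n else 0)"
proof -
  have "spanning n v"
    using assms by (simp add: hadamard_basis_def)
  then obtain a where a: "\<forall>k\<in>{1..n}. (if k = j then 1 else 0) = (\<Sum>i=1..n. a i * v i k)"
    unfolding spanning_def by (elim allE[where x="\<lambda>k. if k = j then 1 else 0"] exE)
  have coeff: "v m j = a m * real n" if m: "m \<in> {1..n}" for m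
  proof -
    have "v m j = (\<Sum>k=1..n. (if k = j then 1 else 0) * v m k)"
      using assms by (simp add: if_distrib[of "\<lambda>x. x * _"] sum.delta cong: if_cong)
    also have "\<dots> = (\<Sum>k=1..n. \<Sum>i=1..n. a i * (v i k * v m k))"
      by (intro sum.cong refl) (simp only: a[rule_format] sum_distrib_right mult.assoc)
    also have "\<dots> = (\<Sum>i=1..n. \<Sum>k=1..n. a i * (v i k * v m k))"
      by (rule sum.swap)
    also have "\<dots> = (\<Sum>i=1..n. a i * (if i = m then real n else 0))"
      using assms m by (intro sum.cong refl) (simp only: sum_distrib_left[symmetric] hadamard_rows[OF assms(1) _ m])
    also have "\<dots> = a m * real n"
      using m by (simp add: if_distrib[of "\<lambda>x. _ * x"] sum.delta cong: if_cong)
    finally show ?thesis .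
  qed
  have "(\<Sum>i=1..n. v i j * v i k) = real n * (\<Sum>i=1..n. a i * v i k)"
    unfolding sum_distrib_left by (intro sum.cong refl) (simp add: coeff)
  also have "\<dots> = real n * (if k = j then 1 else 0)"
    using a[rule_format, OF assms(3)] by (rule arg_cong[OF sym])
  finally show ?thesis by simp
qed

text \<open>Parseval's identity for the indicator vector of \<open>S\<close>. Once the squares are
  expanded and the sum over \<open>i\<close> is innermost, column orthogonality leaves only the
  \<open>card S\<close> diagonal terms.\<close>

lemma hadamard_parseval:
  assumes H: "hadamard_basis n v" and S: "S \<subseteq> {1..n}"
  shows "(\<Sum>i=1..n. (\<Sum>j\<in>S. v i j)\<^sup>2) = real n * real (card S)"
proof -
  have fin: "finite S" using S finite_subset by blast
  have "(\<Sum>i=1..n. (\<Sum>j\<in>S. v i j)\<^sup>2) = (\<Sum>i=1..n. \<Sum>j\<in>S. \<Sum>k\<in>S. v i j * v i k)"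
    by (simp add: power2_eq_square sum_product)
  also have "\<dots> = (\<Sum>j\<in>S. \<Sum>i=1..n. \<Sum>k\<in>S. v i j * v i k)"
    by (rule sum.swap)
  also have "\<dots> = (\<Sum>j\<in>S. \<Sum>k\<in>S. \<Sum>i=1..n. v i j * v i k)"
    by (intro sum.cong refl sum.swap)
  also have "\<dots> = (\<Sum>j\<in>S. \<Sum>k\<in>S. if k = j then real n else 0)"
    using S by (intro sum.cong refl hadamard_columns[OF H]) auto
  also have "\<dots> = real n * real (card S)"
    using fin by (simp add: sum.delta)
  finally show ?thesis .
qed

text \<open>After the sums are exchanged, Cauchy-Schwarz and Parseval bound the square of the
  numerator by \<open>(n * W^2) * (n * card S)\<close>. Its root carries a factor \<open>n\<close>,
  which the division by \<open>n\<close> cancels.\<close>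

lemma hadamard_transform_sum_bound:
  assumes H: "hadamard_basis n v" and S: "S \<subseteq> {1..n}" and "n > 0"
    and w: "\<forall>i\<in>{1..n}. \<bar>w i\<bar> \<le> W" and "W \<ge> 0"
  shows "\<bar>\<Sum>j\<in>S. (\<Sum>i=1..n. v i j * w i) / real n\<bar> \<le> W * sqrt (real (card S))"
proof -
  have eq: "(\<Sum>j\<in>S. (\<Sum>i=1..n. v i j * w i) / real n)
      = (\<Sum>i=1..n. w i * (\<Sum>j\<in>S. v i j)) / real n"
  proof -
    have "(\<Sum>j\<in>S. \<Sum>i=1..n. v i j * w i) = (\<Sum>i=1..n. \<Sum>j\<in>S. v i j * w i)"
      by (rule sum.swap)
    then show ?thesis
      by (simp add: sum_divide_distrib[symmetric] sum_distrib_left mult.commute)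
  qed
  have "(\<Sum>i=1..n. w i * (\<Sum>j\<in>S. v i j))\<^sup>2
      \<le> (\<Sum>i=1..n. (w i)\<^sup>2) * (\<Sum>i=1..n. (\<Sum>j\<in>S. v i j)\<^sup>2)"
    by (rule Cauchy_Schwarz_ineq_sum)
  also have "\<dots> \<le> (real n * W\<^sup>2) * (real n * real (card S))"
  proof -
    have "(w i)\<^sup>2 \<le> W\<^sup>2" if "i \<in> {1..n}" for i
      using w that \<open>W \<ge> 0\<close> by (metis abs_le_square_iff abs_of_nonneg)
    then have "(\<Sum>i=1..n. (w i)\<^sup>2) \<le> (\<Sum>i=1..n. W\<^sup>2)"
      by (intro sum_mono) auto
    then show ?thesis
      unfolding hadamard_parseval[OF H S] by (intro mult_right_mono) auto
  qed
  also have "\<dots> = (real n * W * sqrt (real (card S)))\<^sup>2"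
    by (simp add: power_mult_distrib) (simp add: power2_eq_square)
  finally have "\<bar>\<Sum>i=1..n. w i * (\<Sum>j\<in>S. v i j)\<bar> \<le> \<bar>real n * W * sqrt (real (card S))\<bar>"
    unfolding abs_le_square_iff .
  then have "\<bar>\<Sum>i=1..n. w i * (\<Sum>j\<in>S. v i j)\<bar> \<le> real n * W * sqrt (real (card S))"
    using \<open>W \<ge> 0\<close> by simp
  then show ?thesis
    unfolding eq using \<open>n > 0\<close> by (simp add: field_simps)
qed

section \<open>Exactness on linear functions and the reconstruction error\<close>

lemma sum_pos_set_minus_neg_set:
  assumes "hadamard_basis n v" "i \<in> {1..n}"
  shows "sum c (pos_set n v i) - sum c (neg_set n v i) = (\<Sum>k=1..n. v i k * c k)"
proof -
  have "(\<Sum>k=1..n. v i k * c k)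
      = (\<Sum>k\<in>neg_set n v i. v i k * c k) + (\<Sum>k\<in>pos_set n v i. v i k * c k)"
    unfolding neg_set_def by (rule sum.subset_diff) (auto simp: pos_set_def)
  moreover have "(\<Sum>k\<in>pos_set n v i. v i k * c k) = sum c (pos_set n v i)"
    by (rule sum.cong) (auto simp: pos_set_def)
  moreover have "(\<Sum>k\<in>neg_set n v i. v i k * c k) = (\<Sum>k\<in>neg_set n v i. - c k)"
  proof (rule sum.cong)
    fix k assume "k \<in> neg_set n v i"
    then have "v i k = -1"
      using assms unfolding hadamard_basis_def neg_set_def pos_set_def by blast
    then show "v i k * c k = - c k" by simp
  qed simp
  ultimately show ?thesis by (simp add: sum_negf)
qed

text \<open>After the sums are swapped, column orthogonality leaves only \<open>k = j\<close>. Since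
  the constant term of a linear function cancels in the difference of its values on
  \<open>pos_set n v i\<close> and \<open>neg_set n v i\<close>, that difference is the inner sum
  here, so the algorithm recovers linear functions exactly.\<close>

lemma hadamard_inversion:
  assumes H: "hadamard_basis n v" and j: "j \<in> {1..n}"
  shows "(\<Sum>i=1..n. v i j * (\<Sum>k=1..n. v i k * c k)) = real n * c j"
proof -
  have "(\<Sum>i=1..n. v i j * (\<Sum>k=1..n. v i k * c k))
      = (\<Sum>i=1..n. \<Sum>k=1..n. (v i j * v i k) * c k)"
    by (simp add: sum_distrib_left mult.assoc)
  also have "\<dots> = (\<Sum>k=1..n. (\<Sum>i=1..n. v i j * v i k) * c k)"
    by (subst sum.swap) (simp add: sum_distrib_right)
  also have "\<dots> = (\<Sum>k=1..n. (if k = j then real n else 0) * c k)"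
    using j by (intro sum.cong refl) (simp only: hadamard_columns[OF H j])
  also have "\<dots> = real n * c j"
    using j by (simp add: if_distrib[of "\<lambda>x. x * _"] sum.delta cong: if_cong)
  finally show ?thesis .
qed

lemma hadamard_reconstruction_error:
  assumes H: "hadamard_basis n v" and one: "\<forall>k\<in>{1..n}. v 1 k = 1" and "n > 0"
    and f: "delta_linear n \<Delta> f"
    and h0: "h 0 = f {}"
    and h: "\<forall>j\<in>{1..n}. h j = (\<Sum>i=1..n. v i j * (f (pos_set n v i) - f (neg_set n v i))) / real n"
    and S: "S \<subseteq> {1..n}"
  shows "\<bar>linear_set_fun h S - f S\<bar> \<le> 4 * (\<Delta> * (1 + sqrt (real (min (card S) (n - card S)))))"
    and "\<Delta> \<ge> 0"
proof -
  from f obtain l c where l: "\<forall>S\<subseteq>{1..n}. l S = linear_set_fun c S"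
    and near: "\<forall>S\<subseteq>{1..n}. \<bar>f S - l S\<bar> \<le> \<Delta>"
    unfolding delta_linear_def is_linear_def by blast
  define g where "g = (\<lambda>S. f S - linear_set_fun c S)"
  have g: "\<bar>g T\<bar> \<le> \<Delta>" if "T \<subseteq> {1..n}" for T
    using near l that by (simp add: g_def)
  from g[OF empty_subsetI] show \<Delta>: "\<Delta> \<ge> 0" by linarith
  define w where "w = (\<lambda>i. g (pos_set n v i) - g (neg_set n v i))"
  \<comment> \<open>As the transform is linear and exact on the linear part, \<open>d j\<close> is
    the deviation of \<open>h j\<close> from \<open>c j\<close>; it depends on the perturbation
    \<open>g\<close> alone.\<close>
  define d where "d = (\<lambda>j. (\<Sum>i=1..n. v i j * w i) / real n)"
  have w: "\<forall>i\<in>{1..n}. \<bar>w i\<bar> \<le> 2 * \<Delta>"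
  proof
    fix i
    have "\<bar>g (pos_set n v i)\<bar> \<le> \<Delta>" "\<bar>g (neg_set n v i)\<bar> \<le> \<Delta>"
      by (rule g, force simp: pos_set_def neg_set_def)+
    then show "\<bar>w i\<bar> \<le> 2 * \<Delta>" unfolding w_def by linarith
  qed
  have hd: "h j = c j + d j" if j: "j \<in> {1..n}" for j
  proof -
    have "f (pos_set n v i) - f (neg_set n v i) = (\<Sum>k=1..n. v i k * c k) + w i"
      if "i \<in> {1..n}" for i
      using sum_pos_set_minus_neg_set[OF H that, of c] by (simp add: w_def g_def linear_set_fun_def)
    then have "(\<Sum>i=1..n. v i j * (f (pos_set n v i) - f (neg_set n v i)))
      = (\<Sum>i=1..n. v i j * (\<Sum>k=1..n. v i k * c k) + v i j * w i)"
      by (intro sum.cong refl) (simp only: distrib_left)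
    also have "\<dots> = real n * c j + (\<Sum>i=1..n. v i j * w i)"
      by (simp only: sum.distrib hadamard_inversion[OF H j])
    finally show ?thesis
      using h j \<open>n > 0\<close> by (simp add: d_def add_divide_distrib)
  qed
  have bound: "\<bar>sum d T\<bar> \<le> 2 * \<Delta> * sqrt (real (card T))" if "T \<subseteq> {1..n}" for T
    unfolding d_def by (rule hadamard_transform_sum_bound[OF H that \<open>n > 0\<close> w]) (simp add: \<Delta>)
  have total: "sum d {1..n} = w 1"
  proof -
    have "real n * sum d {1..n} = (\<Sum>j=1..n. \<Sum>i=1..n. v i j * w i)"
      using \<open>n > 0\<close> by (simp add: d_def sum_divide_distrib[symmetric])
    \<comment> \<open>Inserting the factor \<open>v 1 j = 1\<close> turns the sum over
      \<open>j\<close> into the inner product of rows \<open>1\<close> and \<open>i\<close>, which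
      vanishes unless \<open>i = 1\<close>.\<close>
    also have "\<dots> = (\<Sum>j=1..n. \<Sum>i=1..n. v 1 j * v i j * w i)"
      using one by (intro sum.cong refl) auto
    also have "\<dots> = (\<Sum>i=1..n. (\<Sum>j=1..n. v 1 j * v i j) * w i)"
      unfolding sum_distrib_right by (rule sum.swap)
    also have "\<dots> = (\<Sum>i=1..n. (if i = 1 then real n else 0) * w i)"
    proof (intro sum.cong refl)
      fix i assume "i \<in> {1..n}"
      then have "(\<Sum>j=1..n. v 1 j * v i j) = (if i = 1 then real n else 0)"
        using hadamard_rows[OF H, of 1 i] \<open>n > 0\<close> by auto
      then show "(\<Sum>j=1..n. v 1 j * v i j) * w i = (if i = 1 then real n else 0) * w i"
        by simp
    qed
    also have "\<dots> = real n * w 1"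
      using \<open>n > 0\<close> by (simp add: if_distrib[of "\<lambda>x. x * _"] sum.delta cong: if_cong)
    finally show ?thesis using \<open>n > 0\<close> by simp
  qed
  have err: "linear_set_fun h S - f S = g {} - g S + sum d S"
  proof -
    have "sum h S = sum c S + sum d S"
      unfolding sum.distrib[symmetric] using S by (intro sum.cong refl hd) auto
    then show ?thesis by (simp add: linear_set_fun_def g_def h0)
  qed
  have gb: "\<bar>g {}\<bar> \<le> \<Delta>" "\<bar>g S\<bar> \<le> \<Delta>" using g S by auto
  define r where "r = sqrt (real (min (card S) (n - card S)))"
  \<comment> \<open>The summand \<open>2 * \<Delta>\<close> lets both cases share one bound. It is
    spent when \<open>S\<close> is larger than its complement: there \<open>sum d S\<close> is
    \<open>w 1\<close> minus the sum over the complement.\<close>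
  have "\<bar>sum d S\<bar> \<le> 2 * \<Delta> + 2 * (\<Delta> * r)"
  proof (cases "card S \<le> n - card S")
    case True
    then show ?thesis using bound[OF S] \<Delta> by (simp add: r_def min_def)
  next
    case False
    have "sum d {1..n} = sum d ({1..n} - S) + sum d S"
      using S by (intro sum.subset_diff) auto
    moreover have "card ({1..n} - S) = n - card S"
      using S by (simp add: card_Diff_subset finite_subset)
    moreover have "\<bar>w 1\<bar> \<le> 2 * \<Delta>" using w \<open>n > 0\<close> by auto
    ultimately have "\<bar>sum d S\<bar> \<le> 2 * \<Delta> + 2 * \<Delta> * sqrt (real (n - card S))"
      using bound[of "{1..n} - S"] total by (simp del: One_nat_def)
    with False show ?thesis by (simp add: r_def min_def)
  qed
  moreover have "\<Delta> * r \<ge> 0" using \<Delta> by (simp add: r_def)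
  \<comment> \<open>\<open>g {}\<close> and \<open>g S\<close> cost \<Delta> each, so the total is
    \<open>4 * \<Delta> + 2 * (\<Delta> * r)\<close>; rounding the second coefficient up to 4 gives
    a single constant.\<close>
  ultimately have "\<bar>g {} - g S + sum d S\<bar> \<le> 4 * (\<Delta> * (1 + r))"
    using gb \<Delta> unfolding distrib_left by linarith
  then show "\<bar>linear_set_fun h S - f S\<bar>
      \<le> 4 * (\<Delta> * (1 + sqrt (real (min (card S) (n - card S)))))"
    unfolding err r_def .
qed


section \<open>Weakest preconditions with running time\<close>

text \<open>Total correctness: termination is part of the claim. The postcondition also sees the
  time and the queries, so that one pass through the program settles all three.\<close>

definition run :: "nat \<Rightarrow> (nat set \<Rightarrow> real) \<Rightarrow> cmd \<Rightarrow> state \<Rightarrow> (state \<Rightarrow> nat \<Rightarrow> nat set list \<Rightarrow> bool) \<Rightarrow> bool"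
  where "run n f c s Q \<longleftrightarrow> (\<exists>s' t qs. exec n f c s s' t qs \<and> Q s' t qs)"

text \<open>Executions are deterministic, so the existential in \<open>run\<close> collapses to the
  one known outcome. This yields rewriting equations for the basic commands.\<close>

lemma run_if_exec:
  "exec n f c s s' t qs \<Longrightarrow> run n f c s Q \<longleftrightarrow> Q s' t qs"
  unfolding run_def by (blast dest: exec_deterministic)

lemma run_ISet [simp]: "run n f (ISet x e) s Q \<longleftrightarrow> Q (iset x (ival e s) s) (icost e + 1) []"
  by (rule run_if_exec[OF exec.ISet])

lemma run_RSet [simp]:
  "run n f (RSet a es p) s Q \<longleftrightarrow>
     Q (rset a (map (\<lambda>e. ival e s) es) (rval p s) s) (sum_list (map icost es) + rcost p + 1) []"
  by (rule run_if_exec[OF exec.RSet])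

lemma run_Query [simp]:
  "run n f (Query b es a) s Q \<longleftrightarrow>
     Q (rset b (map (\<lambda>e. ival e s) es) (f (indicated_set n a s)) s)
       (sum_list (map icost es) + n + 1) [indicated_set n a s]"
  by (rule run_if_exec[OF exec.Query[OF refl]])

lemma run_Seq [simp]:
  "run n f (c ;; d) s Q \<longleftrightarrow> run n f c s (\<lambda>s' t qs. run n f d s' (\<lambda>s'' u rs. Q s'' (t + u) (qs @ rs)))"
  unfolding run_def by (fastforce intro: exec.Seq elim: SeqE)

lemma run_Cond [simp]:
  "run n f (Cond b c d) s Q \<longleftrightarrow>
     (if bval b s then run n f c s (\<lambda>s' t. Q s' (bcost b + t)) else run n f d s (\<lambda>s' t. Q s' (bcost b + t)))"
  unfolding run_def by (cases "bval b s") (fastforce intro: exec.CondTrue exec.CondFalse elim: CondE)+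

lemma run_mono:
  assumes "run n f c s Q" and "\<And>s' t qs. Q s' t qs \<Longrightarrow> R s' t qs"
  shows "run n f c s R"
  using assms unfolding run_def by blast

text \<open>A single unfolding of the loop, kept as a one-way rule because as a rewriting equation
  it would unfold without end.\<close>

lemma run_While:
  assumes "if bval b s
    then run n f c s (\<lambda>s' t qs. run n f (While b c) s' (\<lambda>s'' u rs. Q s'' (bcost b + t + u) (qs @ rs)))
    else Q s (bcost b) []"
  shows "run n f (While b c) s Q"
  using assms unfolding run_def
  by (cases "bval b s") (fastforce intro: exec.WhileTrue exec.WhileFalse)+

section \<open>State updates and counting loops\<close>

lemma iset_simps [simp]:
  "fst (iset x m s) = (fst s)(x := m)" "snd (iset x m s) = snd s"
  by (simp_all add: iset_def)

lemma rset_simps [simp]: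
  "fst (rset a is r s) = fst s" "snd (rset a is r s) = (snd s)(a := (snd s a)(is := r))"
  by (simp_all add: rset_def)

text \<open>The invariant \<open>I i\<close> takes the set of queries submitted by the iterations before the \<open>i\<close>-th.\<close>

lemma run_For:
  assumes n: "fst s ''n'' = n" and x: "x \<noteq> ''n''"
    and init: "I 1 (iset x 1 s) {}"
    and step: "\<And>i s qs. 1 \<le> i \<Longrightarrow> i \<le> n \<Longrightarrow> fst s x = i \<Longrightarrow> fst s ''n'' = n \<Longrightarrow> I i s qs \<Longrightarrow>
      run n f c s (\<lambda>s' t rs. t \<le> T \<and> fst s' x = i \<and> fst s' ''n'' = n \<and>
        I (Suc i) (iset x (Suc i) s') (qs \<union> set rs))"
    and final: "\<And>s t qs. fst s ''n'' = n \<Longrightarrow> I (Suc n) s (set qs) \<Longrightarrow> t \<le> 5 + n * (T + 6) \<Longrightarrow> Q s t qs"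
  shows "run n f (For x c) s Q"
proof -
  let ?w = "While (ILe (IVar x) (IVar ''n'')) (c ;; ISet x (ISucc (IVar x)))"
  \<comment> \<open>Induction on the number \<open>m\<close> of remaining iterations; the counter
    leaves the loop at \<open>Suc n\<close>. The failing test costs 3, each iteration adds 3 for the
    test and 3 for the increment to \<open>T\<close>, and the initial assignment costs 2, which
    gives \<open>5 + n * (T + 6)\<close>.\<close>
  have loop: "run n f ?w s (\<lambda>s' t rs. fst s' ''n'' = n \<and> I (Suc n) s' (Q \<union> set rs) \<and>
      t \<le> 3 + m * (T + 6))"
    if "m = Suc n - i" "1 \<le> i" "i \<le> Suc n" "fst s x = i" "fst s ''n'' = n" "I i s Q" for m i s Q
    using that
  proof (induction m arbitrary: i s Q)
    case 0
    then have "i = Suc n" by simp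
    with 0 show ?case by (intro run_While) simp
  next
    case (Suc m)
    then have i: "i \<le> n" by linarith
    have "run n f c s (\<lambda>s' t rs. t \<le> T \<and> fst s' x = i \<and> fst s' ''n'' = n \<and>
        I (Suc i) (iset x (Suc i) s') (Q \<union> set rs))"
      using Suc.prems i by (intro step) auto
    then have "run n f c s (\<lambda>s' t rs. run n f ?w (iset x (Suc i) s') (\<lambda>s'' u ts.
        t \<le> T \<and> fst s' x = i \<and> fst s'' ''n'' = n \<and> I (Suc n) s'' (Q \<union> set rs \<union> set ts) \<and>
        u \<le> 3 + m * (T + 6)))"
    proof (rule run_mono, elim conjE)
      fix s' t rs
      assume *: "t \<le> T" "fst s' x = i" "fst s' ''n'' = n"
        "I (Suc i) (iset x (Suc i) s') (Q \<union> set rs)"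
      have "run n f ?w (iset x (Suc i) s') (\<lambda>s'' u ts.
          fst s'' ''n'' = n \<and> I (Suc n) s'' ((Q \<union> set rs) \<union> set ts) \<and> u \<le> 3 + m * (T + 6))"
        using * Suc.prems i x by (intro Suc.IH) auto
      then show "run n f ?w (iset x (Suc i) s') (\<lambda>s'' u ts.
          t \<le> T \<and> fst s' x = i \<and> fst s'' ''n'' = n \<and> I (Suc n) s'' (Q \<union> set rs \<union> set ts) \<and>
          u \<le> 3 + m * (T + 6))"
        by (rule run_mono) (use * in simp)
    qed
    \<comment> \<open>The same fact with the counter read off the state after the body, which is how
      running the increment presents it.\<close>
    then have body: "run n f c s (\<lambda>s' t rs. run n f ?w (iset x (Suc (fst s' x)) s') (\<lambda>s'' u ts.
        t \<le> T \<and> fst s'' ''n'' = n \<and> I (Suc n) s'' (Q \<union> (set rs \<union> set ts)) \<and>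
        u \<le> 3 + m * (T + 6)))"
      apply (rule run_mono)
      subgoal for s' t rs
        unfolding run_def by (auto simp: Un_assoc)
      done
    show ?case
      apply (rule run_While)
      using Suc.prems(2-) i apply simp
      apply (rule run_mono[OF body])
      apply (erule run_mono)
      apply auto
      done
  qed
  show ?thesis
    unfolding For_def
    apply simp
    apply (rule run_mono[OF loop[of n "Suc 0" "iset x (Suc 0) s" "{}"]])
    using n x init final by auto
qed


section \<open>The program\<close>

text \<open>The zeroed array \<open>A\<close> encodes the empty set. The loop takes at most
  \<open>5 + 10 * n\<close> and the query \<open>n + 2\<close>.\<close>

lemma run_query_empty:
  assumes "fst s ''n'' = n"
  shows "run n f query_empty s (\<lambda>s' t qs. fst s' ''n'' = n \<and> snd s' ''v'' = snd s ''v'' \<and>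
    snd s' ''h'' [0] = f {} \<and> set qs = {{}} \<and> t \<le> 7 + n * 11)"
  unfolding query_empty_def run_Seq
\<comment> \<open>The half-open range lists the entries written before iteration \<open>i\<close>,
  hence all of them at exit, where \<open>i = Suc n\<close>. The body costs 3, so 4 is a safe
  bound.\<close>
proof (rule run_For[where T = 4 and
      I = "\<lambda>i s' qs. (\<forall>k\<in>{1..<i}. snd s' ''A'' [k] = 0) \<and> snd s' ''v'' = snd s ''v'' \<and> qs = {}"])
  fix s' :: state and t :: nat and qs :: "nat set list"
  assume *: "fst s' ''n'' = n"
    "(\<forall>k\<in>{1..<Suc n}. snd s' ''A'' [k] = 0) \<and> snd s' ''v'' = snd s ''v'' \<and> set qs = {}"
    "t \<le> 5 + n * (4 + 6)"
  then have "indicated_set n ''A'' s' = {}"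
    by (auto simp: indicated_set_def)
  with * show "run n f (Query ''h'' [IConst 0] ''A'') s' (\<lambda>s'' u rs. fst s'' ''n'' = n \<and>
      snd s'' ''v'' = snd s ''v'' \<and> snd s'' ''h'' [0] = f {} \<and> set (qs @ rs) = {{}} \<and>
      t + u \<le> 7 + n * 11)"
    by simp
qed (use assms in simp_all)

section \<open>Querying the sets given by the basis\<close>

definition loaded :: "nat \<Rightarrow> (nat \<Rightarrow> nat \<Rightarrow> real) \<Rightarrow> state \<Rightarrow> bool" where
  "loaded n v s \<longleftrightarrow> (\<forall>i\<in>{1..n}. \<forall>k\<in>{1..n}. snd s ''v'' [i, k] = v i k)"

lemma loaded_frame [simp]:
  "loaded n v (iset x m s) = loaded n v s"
  "a \<noteq> ''v'' \<Longrightarrow> loaded n v (rset a is r s) = loaded n v s"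
  by (simp_all add: loaded_def)

lemma loadedD: "loaded n v s \<Longrightarrow> i \<in> {1..n} \<Longrightarrow> k \<in> {1..n} \<Longrightarrow> snd s ''v'' [i, k] = v i k"
  by (simp add: loaded_def)

text \<open>Progress of the outer loop: the rows below \<open>m\<close> are finished. It is vacuous
  for \<open>m = 1\<close> and covers all rows for \<open>m = Suc n\<close>.\<close>

definition basis_queried :: "nat \<Rightarrow> (nat \<Rightarrow> nat \<Rightarrow> real) \<Rightarrow> (nat set \<Rightarrow> real) \<Rightarrow> nat \<Rightarrow> state \<Rightarrow> bool" where
  "basis_queried n v f m s \<longleftrightarrow> (\<forall>i\<in>{1..<m}.
     (\<forall>k\<in>{1..n}. snd s ''y'' [i, k] = v i k / sqrt (real n)) \<and>
     snd s ''p'' [i] = f (pos_set n v i) \<and> snd s ''q'' [i] = f (neg_set n v i))"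

text \<open>The third rule is the important one: writes whose first index is at least
  \<open>m\<close> do not touch the finished rows, so the current row can be filled while the
  invariant stands.\<close>

lemma basis_queried_frame [simp]:
  "basis_queried n v f m (iset x l s) = basis_queried n v f m s"
  "a \<notin> {''y'', ''p'', ''q''} \<Longrightarrow> basis_queried n v f m (rset a is r s) = basis_queried n v f m s"
  "m \<le> i \<Longrightarrow> basis_queried n v f m (rset a (i # is) r s) = basis_queried n v f m s"
  by (auto simp: basis_queried_def)

lemma basis_queried_1: "basis_queried n v f (Suc 0) s"
  by (simp add: basis_queried_def)

lemma basis_queried_Suc:
  "1 \<le> m \<Longrightarrow> basis_queried n v f (Suc m) s \<longleftrightarrow> basis_queried n v f m s \<and>
     (\<forall>k\<in>{1..n}. snd s ''y'' [m, k] = v m k / sqrt (real n)) \<and>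
     snd s ''p'' [m] = f (pos_set n v m) \<and> snd s ''q'' [m] = f (neg_set n v m)"
  unfolding basis_queried_def atLeastLessThanSuc by auto

definition indicators_filled :: "nat \<Rightarrow> (nat \<Rightarrow> nat \<Rightarrow> real) \<Rightarrow> nat \<Rightarrow> nat \<Rightarrow> state \<Rightarrow> bool" where
  "indicators_filled n v i m s \<longleftrightarrow> (\<forall>k\<in>{1..<m}.
     snd s ''A'' [k] = (if v i k = 1 then 1 else 0) \<and>
     snd s ''B'' [k] = (if v i k = 1 then 0 else 1) \<and>
     snd s ''y'' [i, k] = v i k / sqrt (real n))"

lemma indicators_filled_frame [simp]:
  "indicators_filled n v i m (iset x l s) = indicators_filled n v i m s"
  "a \<notin> {''A'', ''B'', ''y''} \<Longrightarrow> indicators_filled n v i m (rset a is r s) = indicators_filled n v i m s"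
  "m \<le> k \<Longrightarrow> indicators_filled n v i m (rset a [k] r s) = indicators_filled n v i m s"
  "m \<le> k \<Longrightarrow> indicators_filled n v i m (rset a [l, k] r s) = indicators_filled n v i m s"
  by (auto simp: indicators_filled_def)

lemma indicators_filled_1: "indicators_filled n v i (Suc 0) s"
  by (simp add: indicators_filled_def)

lemma indicators_filled_Suc:
  "1 \<le> m \<Longrightarrow> indicators_filled n v i (Suc m) s \<longleftrightarrow> indicators_filled n v i m s \<and>
     snd s ''A'' [m] = (if v i m = 1 then 1 else 0) \<and>
     snd s ''B'' [m] = (if v i m = 1 then 0 else 1) \<and>
     snd s ''y'' [i, m] = v i m / sqrt (real n)"
  unfolding indicators_filled_def atLeastLessThanSuc by auto

lemma indicators_filledD:
  assumes "indicators_filled n v i (Suc n) s"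
  shows "indicated_set n ''A'' s = pos_set n v i" "indicated_set n ''B'' s = neg_set n v i"
    and "\<forall>k\<in>{1..n}. snd s ''y'' [i, k] = v i k / sqrt (real n)"
  using assms
  by (auto simp: indicators_filled_def indicated_set_def pos_set_def neg_set_def split: if_splits)

lemma indicated_set_rset [simp]:
  "a \<noteq> b \<Longrightarrow> indicated_set n a (rset b is r s) = indicated_set n a s"
  by (simp add: indicated_set_def)

lemma run_query_basis:
  assumes "fst s ''n'' = n" "loaded n v s" and H: "hadamard_basis n v"
  shows "run n f query_basis s (\<lambda>s' t qs. fst s' ''n'' = n \<and>
    snd s' ''h'' = snd s ''h'' \<and> basis_queried n v f (Suc n) s' \<and>
    set qs = pos_set n v ` {1..n} \<union> neg_set n v ` {1..n} \<and> t \<le> 5 + n * (15 + 34 * n))"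
  unfolding query_basis_def
\<comment> \<open>The inner loop, with body bound 26, takes at most \<open>5 + n * 32\<close>, and
  the two queries take \<open>n + 2\<close> each.\<close>
proof (rule run_For[where T = "9 + n * 34" and
      I = "\<lambda>i s' qs. loaded n v s' \<and> snd s' ''h'' = snd s ''h'' \<and> basis_queried n v f i s' \<and>
        qs = pos_set n v ` {1..<i} \<union> neg_set n v ` {1..<i}"], goal_cases)
  case (4 i s1 qs)
  \<comment> \<open>The program tests for positivity, while \<open>pos_set\<close> asks for the
    value 1; on entries 1 and -1 the two agree.\<close>
  have sign: "0 < v i k \<longleftrightarrow> v i k = 1" if "k \<in> {1..n}" for k
  proof -
    have "v i k \<in> {1, -1}"
      using H that 4 by (simp add: hadamard_basis_def)
    then show ?thesis by auto
  qed
  show ?case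
    unfolding run_Seq
  proof (rule run_For[where T = 26 and
        I = "\<lambda>k s' rs. fst s' ''i'' = i \<and> loaded n v s' \<and> snd s' ''h'' = snd s ''h'' \<and>
          basis_queried n v f i s' \<and> indicators_filled n v i k s' \<and> rs = {}"], goal_cases)
    case (4 k s2 rs)
    then have "snd s2 ''v'' [i, k] = v i k" "0 < v i k \<longleftrightarrow> v i k = 1"
      using \<open>1 \<le> i\<close> \<open>i \<le> n\<close> loadedD[of n v s2 i k] by (simp_all add: sign)
    with 4 show ?case
      by (cases "v i k = 1") (simp_all add: indicators_filled_Suc)
  next
    case (5 s2 t rs)
    then have "indicated_set n ''A'' s2 = pos_set n v i" "indicated_set n ''B'' s2 = neg_set n v i"
      "\<forall>k\<in>{1..n}. snd s2 ''y'' [i, k] = v i k / sqrt (real n)"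
      using indicators_filledD[of n v i s2] by simp_all
    with 5 show ?case
      using \<open>1 \<le> i\<close> 4
      by (simp add: basis_queried_Suc atLeastLessThanSuc Un_ac insert_commute)
  qed (use 4 in \<open>simp_all add: indicators_filled_1\<close>)
qed (use assms in \<open>simp_all add: basis_queried_1 algebra_simps atLeastLessThanSuc_atLeastAtMost\<close>)

section \<open>Computing the coefficients\<close>

definition coeffs_computed :: "nat \<Rightarrow> (nat \<Rightarrow> nat \<Rightarrow> real) \<Rightarrow> (nat set \<Rightarrow> real) \<Rightarrow> nat \<Rightarrow> state \<Rightarrow> bool" where
  "coeffs_computed n v f m s \<longleftrightarrow> (\<forall>j\<in>{1..<m}.
     (\<forall>i\<in>{1..n}. snd s ''lambda'' [j, i] = v i j / sqrt (real n)) \<and>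
     snd s ''h'' [j] = 1 / sqrt (real n) *
       (\<Sum>i=1..n. v i j / sqrt (real n) * (f (pos_set n v i) - f (neg_set n v i))))"

lemma coeffs_computed_frame [simp]:
  "coeffs_computed n v f m (iset x l s) = coeffs_computed n v f m s"
  "m \<le> j \<Longrightarrow> coeffs_computed n v f m (rset a (j # is) r s) = coeffs_computed n v f m s"
  by (auto simp: coeffs_computed_def)

lemma coeffs_computed_1: "coeffs_computed n v f (Suc 0) s"
  by (simp add: coeffs_computed_def)

lemma coeffs_computed_Suc:
  "1 \<le> m \<Longrightarrow> coeffs_computed n v f (Suc m) s \<longleftrightarrow> coeffs_computed n v f m s \<and>
     (\<forall>i\<in>{1..n}. snd s ''lambda'' [m, i] = v i m / sqrt (real n)) \<and>
     snd s ''h'' [m] = 1 / sqrt (real n) *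
       (\<Sum>i=1..n. v i m / sqrt (real n) * (f (pos_set n v i) - f (neg_set n v i)))"
  unfolding coeffs_computed_def atLeastLessThanSuc by auto

lemma run_compute_coeffs:
  assumes "fst s ''n'' = n" "basis_queried n v f (Suc n) s"
  shows "run n f compute_coeffs s (\<lambda>s' t qs. coeffs_computed n v f (Suc n) s' \<and>
    snd s' ''h'' [0] = snd s ''h'' [0] \<and> qs = [] \<and> t \<le> 5 + n * (29 + 32 * n))"
  unfolding compute_coeffs_def
\<comment> \<open>The two inner loops take at most \<open>5 + n * 12\<close> and
  \<open>5 + n * 20\<close>; clearing the accumulator costs 3 and the final scaling 10.\<close>
proof (rule run_For[where T = "23 + n * 32" and
      I = "\<lambda>j s' qs. basis_queried n v f (Suc n) s' \<and> coeffs_computed n v f j s' \<and>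
        snd s' ''h'' [0] = snd s ''h'' [0] \<and> qs = {}"], goal_cases)
  case (4 j s1 qs)
  then have qs: "qs = {}" by simp
  let ?frame = "\<lambda>s'. fst s' ''j'' = j \<and> basis_queried n v f (Suc n) s' \<and>
    coeffs_computed n v f j s' \<and> snd s' ''h'' [0] = snd s ''h'' [0]"
  let ?lambda = "\<lambda>m s'. \<forall>i\<in>{1..<m}. snd s' ''lambda'' [j, i] = v i j / sqrt (real n)"
  show ?case
    unfolding run_Seq
  proof (rule run_For[where T = 6 and I = "\<lambda>i s' rs. ?frame s' \<and> ?lambda i s' \<and> rs = {}"],
      goal_cases)
    case (4 i s2 rs)
    then have "snd s2 ''y'' [i, j] = v i j / sqrt (real n)"
      using \<open>1 \<le> j\<close> \<open>j \<le> n\<close> by (simp add: basis_queried_def)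
    with 4 show ?case
      by (simp add: atLeastLessThanSuc)
  next
    case (5 s2 t rs)
    then show ?case
      unfolding run_RSet
    \<comment> \<open>Entry \<open>j\<close> of \<open>h\<close> accumulates the unscaled partial
      sum; the factor \<open>1 / sqrt n\<close> comes after the loop. The limit in
      \<open>{1..<i}\<close> is the loop index, not the summation variable of the same name. Entry 0
      survives because \<open>j\<close> is at least 1.\<close>
    proof (intro run_For[where T = 14 and I = "\<lambda>i s' rs. ?frame s' \<and> ?lambda (Suc n) s' \<and> rs = {} \<and>
        snd s' ''h'' [j] =
          (\<Sum>i\<in>{1..<i}. v i j / sqrt (real n) * (f (pos_set n v i) - f (neg_set n v i)))"],
        goal_cases)
      case (4 i s3 rs)
      then have "snd s3 ''p'' [i] = f (pos_set n v i)" "snd s3 ''q'' [i] = f (neg_set n v i)"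
        "snd s3 ''lambda'' [j, i] = v i j / sqrt (real n)"
        by (simp_all add: basis_queried_def)
      with 4 show ?case
        using \<open>1 \<le> j\<close> by (simp add: atLeastLessThanSuc)
    next
      case (5 s3 u ts)
      then show ?case
        using \<open>1 \<le> j\<close> qs
        by (simp add: coeffs_computed_Suc atLeastLessThanSuc_atLeastAtMost)
    qed (use \<open>1 \<le> j\<close> in simp_all)
  qed (use 4 in simp_all)
qed (use assms in \<open>simp_all add: coeffs_computed_1 algebra_simps\<close>)

section \<open>The whole program and its guarantees\<close>

lemma run_hadamard_alg:
  assumes "fst s ''n'' = n" "loaded n v s" and H: "hadamard_basis n v"
  shows "run n f hadamard_alg s (\<lambda>s' t qs. coeffs_computed n v f (Suc n) s' \<and>
    snd s' ''h'' [0] = f {} \<and>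
    set qs = {{}} \<union> pos_set n v ` {1..n} \<union> neg_set n v ` {1..n} \<and>
    t \<le> 17 + n * (55 + n * 66))"
  unfolding hadamard_alg_def run_Seq
proof (rule run_mono[OF run_query_empty[OF assms(1)]], elim conjE)
  fix s1 :: state and t1 :: nat and qs1 :: "nat set list"
  assume 1: "fst s1 ''n'' = n" "snd s1 ''v'' = snd s ''v''" "snd s1 ''h'' [0] = f {}"
    "set qs1 = {{}}" "t1 \<le> 7 + n * 11"
  then have "loaded n v s1"
    using assms by (simp add: loaded_def)
  show "run n f query_basis s1 (\<lambda>s2 t2 qs2. run n f compute_coeffs s2 (\<lambda>s' t3 qs3.
      coeffs_computed n v f (Suc n) s' \<and> snd s' ''h'' [0] = f {} \<and>
      set (qs1 @ (qs2 @ qs3)) = {{}} \<union> pos_set n v ` {1..n} \<union> neg_set n v ` {1..n} \<and>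
      t1 + (t2 + t3) \<le> 17 + n * (55 + n * 66)))"
  proof (rule run_mono[OF run_query_basis[OF 1(1) \<open>loaded n v s1\<close> H]], elim conjE)
    fix s2 :: state and t2 :: nat and qs2 :: "nat set list"
    assume 2: "fst s2 ''n'' = n" "snd s2 ''h'' = snd s1 ''h''" "basis_queried n v f (Suc n) s2"
      "set qs2 = pos_set n v ` {1..n} \<union> neg_set n v ` {1..n}" "t2 \<le> 5 + n * (15 + 34 * n)"
    show "run n f compute_coeffs s2 (\<lambda>s' t3 qs3.
        coeffs_computed n v f (Suc n) s' \<and> snd s' ''h'' [0] = f {} \<and>
        set (qs1 @ (qs2 @ qs3)) = {{}} \<union> pos_set n v ` {1..n} \<union> neg_set n v ` {1..n} \<and>
        t1 + (t2 + t3) \<le> 17 + n * (55 + n * 66))"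
      \<comment> \<open>The phase bounds \<open>7 + n * 11\<close>,
        \<open>5 + n * (15 + 34 * n)\<close> and \<open>5 + n * (29 + 32 * n)\<close> add up exactly
        to the claimed one; the last phase submits no query.\<close>
      by (rule run_mono[OF run_compute_coeffs[OF 2(1,3)]])
        (use 1 2 in \<open>simp add: algebra_simps\<close>)
  qed
qed

text \<open>The expansion of the unit vectors is column orthogonality divided by \<open>n\<close>.
  In the second form the two factors \<open>1 / sqrt n\<close> are merged into the
  \<open>1 / n\<close> that the error estimate works with.\<close>

lemma hadamard_coeffs_if_computed:
  assumes H: "hadamard_basis n v" and s: "coeffs_computed n v f (Suc n) s" "snd s ''h'' [0] = f {}"
  shows "hadamard_coeffs n v f (lambda_array s) (output_coeffs s)"
    and "\<forall>j\<in>{1..n}. output_coeffs s j =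
      (\<Sum>i=1..n. v i j * (f (pos_set n v i) - f (neg_set n v i))) / real n"
proof -
  have lam: "lambda_array s j i = v i j / sqrt (real n)" if "j \<in> {1..n}" "i \<in> {1..n}" for i j
    using s that by (simp add: coeffs_computed_def lambda_array_def)
  have h: "output_coeffs s j = 1 / sqrt (real n) *
      (\<Sum>i=1..n. v i j / sqrt (real n) * (f (pos_set n v i) - f (neg_set n v i)))"
    if "j \<in> {1..n}" for j
    using s that by (simp add: coeffs_computed_def output_coeffs_def)
  have "(if k = j then 1 else 0) = (\<Sum>i=1..n. lambda_array s j i * (v i k / sqrt (real n)))"
    if "j \<in> {1..n}" "k \<in> {1..n}" for j k
  proof -
    have "(\<Sum>i=1..n. lambda_array s j i * (v i k / sqrt (real n)))
        = (\<Sum>i=1..n. v i j * v i k) / real n"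
      unfolding sum_divide_distrib using that by (intro sum.cong refl) (simp add: lam)
    then show ?thesis
      unfolding hadamard_columns[OF H that] using that by auto
  qed
  moreover have "output_coeffs s 0 = f {}"
    using s by (simp add: output_coeffs_def)
  ultimately show "hadamard_coeffs n v f (lambda_array s) (output_coeffs s)"
    unfolding hadamard_coeffs_def by (simp add: h lam)
  show "\<forall>j\<in>{1..n}. output_coeffs s j =
      (\<Sum>i=1..n. v i j * (f (pos_set n v i) - f (neg_set n v i))) / real n"
    by (simp add: h sum_distrib_left sum_divide_distrib)
qed

theorem theorem9:
  "\<exists>(C :: real) (C' :: real) (P :: nat poly).
     \<forall>(n :: nat) (v :: nat \<Rightarrow> nat \<Rightarrow> real) (f :: nat set \<Rightarrow> real) (\<Delta> :: real).
       (\<exists>m :: nat. n = 2 ^ m) \<longrightarrow> hadamard_basis n v \<longrightarrow> (\<forall>k\<in>{1..n}. v 1 k = 1) \<longrightarrow>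
       delta_linear n \<Delta> f \<longrightarrow>
       (\<exists>s t qs.
          exec n f hadamard_alg (input_state n v) s t qs \<and>
          t \<le> poly P n \<and>
          set qs = {{}} \<union> pos_set n v ` {1..n} \<union> neg_set n v ` {1..n} \<and>
          hadamard_coeffs n v f (lambda_array s) (output_coeffs s) \<and>
          (\<forall>S\<subseteq>{1..n}.
             \<bar>linear_set_fun (output_coeffs s) S - f S\<bar>
               \<le> C * (\<Delta> * (1 + sqrt (real (min (card S) (n - card S)))))) \<and>
          (\<forall>S\<subseteq>{1..n}.
             \<bar>linear_set_fun (output_coeffs s) S - f S\<bar> \<le> C' * (\<Delta> * sqrt (real n))))"
\<comment> \<open>4 is the constant of the error estimate. It doubles to 8 because
  \<open>1 + r\<close> is at most \<open>2 * sqrt n\<close> for the root \<open>r\<close> in the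
  finer bound. The polynomial is the time bound, constant coefficient first.\<close>
proof (rule exI[of _ 4], rule exI[of _ 8], rule exI[of _ "[:17, 55, 66:]"], intro allI impI)
  fix n :: nat and v :: "nat \<Rightarrow> nat \<Rightarrow> real" and f :: "nat set \<Rightarrow> real" and \<Delta> :: real
  assume "\<exists>m. n = 2 ^ m" and H: "hadamard_basis n v" and one: "\<forall>k\<in>{1..n}. v 1 k = 1"
    and f: "delta_linear n \<Delta> f"
  then have n: "n > 0" by auto
  have "run n f hadamard_alg (input_state n v) (\<lambda>s' t qs. coeffs_computed n v f (Suc n) s' \<and>
      snd s' ''h'' [0] = f {} \<and>
      set qs = {{}} \<union> pos_set n v ` {1..n} \<union> neg_set n v ` {1..n} \<and>
      t \<le> 17 + n * (55 + n * 66))"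
    by (rule run_hadamard_alg) (auto simp: H input_state_def loaded_def)
  then obtain s t qs where e: "exec n f hadamard_alg (input_state n v) s t qs"
    and s: "coeffs_computed n v f (Suc n) s" "snd s ''h'' [0] = f {}"
    and qs: "set qs = {{}} \<union> pos_set n v ` {1..n} \<union> neg_set n v ` {1..n}"
    and t: "t \<le> 17 + n * (55 + n * 66)"
    unfolding run_def by (elim exE conjE)
  note err = hadamard_reconstruction_error[OF H one n f _ hadamard_coeffs_if_computed(2)[OF H s]]
  have h0: "output_coeffs s 0 = f {}"
    using s by (simp add: output_coeffs_def)
  have coarse: "\<bar>linear_set_fun (output_coeffs s) S - f S\<bar> \<le> 8 * (\<Delta> * sqrt (real n))"
    if "S \<subseteq> {1..n}" for S
  proof -
    define r where "r = sqrt (real (min (card S) (n - card S)))"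
    have "r \<le> sqrt (real n)" "1 \<le> sqrt (real n)"
      using n by (auto simp: r_def)
    then have "\<Delta> * (1 + r) \<le> \<Delta> * (2 * sqrt (real n))"
      by (intro mult_left_mono err(2)[OF h0 that]) linarith
    moreover have "\<bar>linear_set_fun (output_coeffs s) S - f S\<bar> \<le> 4 * (\<Delta> * (1 + r))"
      unfolding r_def by (rule err(1)[OF h0 that])
    ultimately show ?thesis by linarith
  qed
  show "\<exists>s t qs. exec n f hadamard_alg (input_state n v) s t qs \<and>
      t \<le> poly [:17, 55, 66:] n \<and>
      set qs = {{}} \<union> pos_set n v ` {1..n} \<union> neg_set n v ` {1..n} \<and>
      hadamard_coeffs n v f (lambda_array s) (output_coeffs s) \<and>
      (\<forall>S\<subseteq>{1..n}. \<bar>linear_set_fun (output_coeffs s) S - f S\<bar>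
         \<le> 4 * (\<Delta> * (1 + sqrt (real (min (card S) (n - card S)))))) \<and>
      (\<forall>S\<subseteq>{1..n}. \<bar>linear_set_fun (output_coeffs s) S - f S\<bar> \<le> 8 * (\<Delta> * sqrt (real n)))"
  proof (intro exI[of _ s] exI[of _ t] exI[of _ qs] conjI allI impI)
    show "t \<le> poly [:17, 55, 66:] n" using t by simp
  qed (fact e qs hadamard_coeffs_if_computed(1)[OF H s] err(1)[OF h0] coarse)+
qed

end
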